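(* There exists a non-increasing sequence $(a_n)_{n\in\mathbb N}$ of positive real numbers with $\sum_{n=1}^\infty a_n<\infty$ such that the achievement set $E(a_n)$ is a Cantorval and the set $\{n\in\mathbb N:\ a_n\le r_n\}$, where $r_n:=\sum_{i>n}a_i$, has asymptotic density $0$.
   Context: $\mathbb N=\{1,2,3,\ldots\}$. For a sequence $(a_n)_{n\in\mathbb N}$ of non-negative real numbers with $\sum a_n$ convergent, its achievement set (set of subsums) is $$E(a_n):=\Bigl\{x\in\mathbb R:\ \exists A\subset\mathbb N\ \ x=\sum_{n\in A}a_n\Bigr\}$$ (the empty sum is $0$). A Cantor set is a set homeomorphic to the classic ternary Cantor set. A Cantorval is a bounded, regularly closed subset of $\mathbb R$ (i.e. a set equal to the closure of its interior) whose boundary is a Cantor set. The asymptotic density of $A\subset\mathbb N$ is $\lim_{n\to\infty}\frac{1}{n}\operatorname{card}\{k\in A:\ k\le n\}$, if the limit exists. *)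

theory Defs
  imports "HOL-Analysis.Analysis"
begin

text \<open>
  Sequences indexed by the positive integers are functions on \<^typ>\<open>nat\<close> of which only the
  values on \<^term>\<open>{1::nat..}\<close> are ever used; the value at \<open>0\<close> is irrelevant.
\<close>

definition achievement_set :: "(nat \<Rightarrow> real) \<Rightarrow> real set" where
  "achievement_set a = {x. \<exists>A\<subseteq>{1..}. (a has_sum x) A}"

definition tail_sum :: "(nat \<Rightarrow> real) \<Rightarrow> nat \<Rightarrow> real" where
  "tail_sum a n = (\<Sum>\<^sub>\<infinity>i\<in>{n<..}. a i)"

text \<open>
  Removing the open middle third of every component of a stage of the construction
  leaves the union of the two copies of that stage scaled by \<open>1/3\<close> with left ends
  at \<open>0\<close> and \<open>2/3\<close>.
\<close>

primrec ternary_stage :: "nat \<Rightarrow> real set" where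
  "ternary_stage 0 = {0..1}"
| "ternary_stage (Suc n) =
     (\<lambda>x. x / 3) ` ternary_stage n \<union> (\<lambda>x. 2 / 3 + x / 3) ` ternary_stage n"

definition ternary_cantor_set :: "real set" where
  "ternary_cantor_set = (\<Inter>n. ternary_stage n)"

definition is_cantor_set :: "'a::topological_space set \<Rightarrow> bool" where
  "is_cantor_set S \<longleftrightarrow> S homeomorphic ternary_cantor_set"

definition is_cantorval :: "real set \<Rightarrow> bool" where
  "is_cantorval S \<longleftrightarrow>
     bounded S \<and> S = closure (interior S) \<and> is_cantor_set (frontier S)"

definition has_asymptotic_density :: "nat set \<Rightarrow> real \<Rightarrow> bool" where
  "has_asymptotic_density A d \<longleftrightarrow>
     (\<lambda>n. real (card {k \<in> A. 1 \<le> k \<and> k \<le> n}) / real n) \<longlonglongrightarrow> d"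

end

theory Submission
  imports Defs
begin

text \<open>
  The sequence is cut into blocks which start at the squares. In a block of length \<open>m + 1\<close> the
  terms are, up to scaling, \<open>2^m + 1, 2^m, ..., 4, 2\<close>, and the next block is scaled down by
  \<open>2^(m+1)\<close>. The powers of \<open>2\<close> exceed the sum of all later terms, so \<open>a n \<le> r n\<close> is
  possible only for squares \<open>n\<close>. The odd first terms fill the holes between the sums of the
  powers of \<open>2\<close>, hence the achievement set of every tail contains an interval and the
  achievement set is regularly closed.

  An isolated point of the frontier would be an end both of a gap and of an interval of the
  achievement set. Next to an end of a gap, however, the achievement set is a copy of a tail near
  \<open>0\<close> (or its mirror image), and infinitely many \<open>n\<close> with \<open>a n > r n\<close> give arbitrarily small gaps
  there. So the frontier is a perfect compact nowhere dense set of reals, that is, a Cantor set.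
\<close>

section \<open>Cantor sets\<close>

text \<open>Words grow at the head: the pieces \<open>c (b # w)\<close> are the two halves of
  \<open>c w\<close>, so the head of a word is the most recent choice. The last clause makes
  diameters vanish uniformly on each level, so a point is determined by the pieces that contain
  it.\<close>

definition cantor_scheme :: "'a::heine_borel set \<Rightarrow> (bool list \<Rightarrow> 'a set) \<Rightarrow> bool" where
  "cantor_scheme K c \<longleftrightarrow> c [] = K \<and>
     (\<forall>w. compact (c w) \<and> c w \<noteq> {} \<and> c (True # w) \<union> c (False # w) = c w \<and>
          c (True # w) \<inter> c (False # w) = {}) \<and>
     (\<forall>e>0. \<exists>n. \<forall>w x y. length w = n \<longrightarrow> x \<in> c w \<longrightarrow> y \<in> c w \<longrightarrow> dist x y < e)"

lemma cantor_schemeD: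
  assumes "cantor_scheme K c"
  shows "c [] = K" "compact (c w)" "c w \<noteq> {}" "c (True # w) \<union> c (False # w) = c w"
    "c (True # w) \<inter> c (False # w) = {}"
    "e > 0 \<Longrightarrow> \<exists>n. \<forall>w x y. length w = n \<longrightarrow> x \<in> c w \<longrightarrow> y \<in> c w \<longrightarrow> dist x y < e"
  using assms by (simp_all add: cantor_scheme_def)

lemma cantor_scheme_Cons_subset: "cantor_scheme K c \<Longrightarrow> c (b # w) \<subseteq> c w"
  using cantor_schemeD(4)[of K c w] by (cases b) auto

lemma cantor_scheme_cover:
  assumes "cantor_scheme K c" "x \<in> K"
  shows "\<exists>w. length w = n \<and> x \<in> c w"
proof (induction n)
  case 0
  then show ?case using assms cantor_schemeD(1) by auto
next
  case (Suc n)
  then obtain w where "length w = n" "x \<in> c w" by blast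
  moreover have "c (True # w) \<union> c (False # w) = c w"
    using assms(1) by (rule cantor_schemeD)
  ultimately show ?case by (metis UnE length_Cons)
qed

lemma cantor_scheme_disjoint:
  assumes "cantor_scheme K c" "length v = length w" "x \<in> c v" "x \<in> c w"
  shows "v = w"
  using assms(2-)
proof (induction v w rule: list_induct2)
  case (Cons a v b w)
  then have "v = w"
    using cantor_scheme_Cons_subset[OF assms(1)] by blast
  moreover have "c (True # w) \<inter> c (False # w) = {}"
    using assms(1) by (rule cantor_schemeD)
  ultimately show ?case using Cons.prems by (cases a; cases b) auto
qed simp

lemma cantor_scheme_subset:
  assumes "cantor_scheme K c"
  shows "c w \<subseteq> K"
proof (induction w)
  case Nil
  then show ?case using assms cantor_schemeD(1) by auto
next
  case (Cons b w)
  then show ?case using cantor_scheme_Cons_subset[OF assms, of b w] by blast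
qed

text \<open>The other pieces of the same level are finitely many compact sets that miss
  \<open>x\<close>, so \<open>x\<close> has a neighbourhood avoiding all of them; what remains of
  \<open>K\<close> there lies in \<open>c w\<close>.\<close>

lemma cantor_scheme_openin:
  assumes c: "cantor_scheme K c" and x: "x \<in> c w"
  shows "\<exists>d>0. \<forall>y\<in>K. dist y x < d \<longrightarrow> y \<in> c w"
proof -
  define V where "V = \<Union> (c ` {v. length v = length w \<and> v \<noteq> w})"
  have "finite {v::bool list. length v = length w \<and> v \<noteq> w}"
    by (rule finite_subset[OF _ finite_lists_length_eq[of "UNIV :: bool set" "length w"]]) auto
  then have "closed V"
    unfolding V_def using cantor_schemeD(2)[OF c]
    by (intro closed_Union finite_imageI) (auto intro: compact_imp_closed)
  moreover have "x \<notin> V"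
    using cantor_scheme_disjoint[OF c] x unfolding V_def by blast
  ultimately obtain d where d: "d > 0" "ball x d \<subseteq> - V"
    by (metis ComplI open_Compl open_contains_ball)
  have "y \<in> c w" if y: "y \<in> K" "dist y x < d" for y
  proof -
    obtain v where "length v = length w" "y \<in> c v"
      using cantor_scheme_cover[OF c y(1), of "length w"] by blast
    moreover have "y \<notin> V"
      using d(2) y(2) by (auto simp: dist_commute subset_iff)
    ultimately show ?thesis unfolding V_def by blast
  qed
  with d(1) show ?thesis by blast
qed

text \<open>The pieces around \<open>x\<close> form a branch of the binary tree; along the same
  branch the pieces of \<open>d\<close> are nested nonempty compact sets and have a common
  point.\<close>

lemma cantor_scheme_corresponding_point:
  assumes c: "cantor_scheme K c" and d: "cantor_scheme L d" and x: "x \<in> K"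
  shows "\<exists>y\<in>L. \<forall>w. x \<in> c w \<longleftrightarrow> y \<in> d w"
proof -
  obtain p where p: "\<And>n. length (p n) = n \<and> x \<in> c (p n)"
    using cantor_scheme_cover[OF c x] by metis
  have step: "d (p (Suc n)) \<subseteq> d (p n)" for n
  proof -
    obtain b v where v: "p (Suc n) = b # v" "length v = n"
      using p[of "Suc n"] by (cases "p (Suc n)") auto
    then have "x \<in> c v"
      using p[of "Suc n"] cantor_scheme_Cons_subset[OF c, of b v] by auto
    then have "v = p n"
      using cantor_scheme_disjoint[OF c, of v "p n" x] p[of n] v(2) by simp
    then show ?thesis
      using cantor_scheme_Cons_subset[OF d, of b v] v(1) by auto
  qed
  have "\<Inter> (range (\<lambda>n. d (p n))) \<noteq> {}"
  proof (rule compact_nest)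
    show "m \<le> n \<Longrightarrow> d (p n) \<subseteq> d (p m)" for m n
      using step by (rule lift_Suc_antimono_le)
  qed (use cantor_schemeD(2,3)[OF d] in auto)
  then obtain y where y: "\<And>n. y \<in> d (p n)" by blast
  have "x \<in> c w \<longleftrightarrow> y \<in> d w" for w
    using p[of "length w"] y[of "length w"] cantor_scheme_disjoint[OF c, of w "p (length w)" x]
      cantor_scheme_disjoint[OF d, of w "p (length w)" y] by auto
  moreover have "y \<in> L"
    using y cantor_scheme_subset[OF d] by blast
  ultimately show ?thesis by blast
qed

text \<open>Continuity combines two facts: deep pieces of \<open>d\<close> are small, and the piece
  of \<open>c\<close> around \<open>x\<close> is relatively open in \<open>K\<close>.\<close>

lemma cantor_scheme_continuous_map:
  assumes c: "cantor_scheme K c" and d: "cantor_scheme L d"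
  obtains h where "continuous_on K h" "h ` K \<subseteq> L"
    "\<And>x w. x \<in> K \<Longrightarrow> x \<in> c w \<longleftrightarrow> h x \<in> d w"
proof -
  obtain h where h: "\<And>x. x \<in> K \<Longrightarrow> h x \<in> L \<and> (\<forall>w. x \<in> c w \<longleftrightarrow> h x \<in> d w)"
    using cantor_scheme_corresponding_point[OF c d] by metis
  have "continuous_on K h"
    unfolding continuous_on_iff
  proof (intro ballI allI impI)
    fix x and e :: real
    assume x: "x \<in> K" and "e > 0"
    then obtain n where n: "\<And>w x y. length w = n \<Longrightarrow> x \<in> d w \<Longrightarrow> y \<in> d w \<Longrightarrow> dist x y < e"
      using cantor_schemeD(6)[OF d] by meson
    obtain w where w: "length w = n" "x \<in> c w"
      using cantor_scheme_cover[OF c x] by blast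
    obtain r where r: "r > 0" "\<forall>y\<in>K. dist y x < r \<longrightarrow> y \<in> c w"
      using cantor_scheme_openin[OF c w(2)] by blast
    have "dist (h y) (h x) < e" if "y \<in> K" "dist y x < r" for y
    proof (rule n[OF w(1)])
      show "h y \<in> d w" using h[OF that(1)] r(2) that by blast
      show "h x \<in> d w" using h[OF x] w(2) by blast
    qed
    then show "\<exists>r>0. \<forall>y\<in>K. dist y x < r \<longrightarrow> dist (h y) (h x) < e"
      using r(1) by blast
  qed
  then show thesis
  proof (rule that)
    show "h ` K \<subseteq> L" using h by blast
    show "x \<in> c w \<longleftrightarrow> h x \<in> d w" if "x \<in> K" for x w using h[OF that] by blast
  qed
qed

text \<open>The points \<open>x\<close> and \<open>g (h x)\<close> lie in the same pieces of
  \<open>c\<close>, and on a deep enough level a piece is too small to hold two distinct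
  points.\<close>

lemma cantor_scheme_inverse:
  assumes c: "cantor_scheme K c" and d: "cantor_scheme L d"
    and h: "\<And>x w. x \<in> K \<Longrightarrow> x \<in> c w \<longleftrightarrow> h x \<in> d w" "h ` K \<subseteq> L"
    and g: "\<And>y w. y \<in> L \<Longrightarrow> y \<in> d w \<longleftrightarrow> g y \<in> c w"
    and x: "x \<in> K"
  shows "g (h x) = x"
proof (rule ccontr)
  assume "g (h x) \<noteq> x"
  then obtain n where n: "\<And>w. length w = n \<Longrightarrow> x \<in> c w \<Longrightarrow> \<not> g (h x) \<in> c w"
    using cantor_schemeD(6)[OF c] by (metis less_irrefl zero_less_dist_iff)
  obtain w where w: "length w = n" "x \<in> c w"
    using cantor_scheme_cover[OF c x] by blast
  then have "g (h x) \<in> c w"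
    using h g x by blast
  with n w show False by blast
qed

lemma cantor_schemes_homeomorphic:
  assumes c: "cantor_scheme K c" and d: "cantor_scheme L d"
  shows "K homeomorphic L"
proof -
  obtain h where h: "continuous_on K h" "h ` K \<subseteq> L" "\<And>x w. x \<in> K \<Longrightarrow> x \<in> c w \<longleftrightarrow> h x \<in> d w"
    using cantor_scheme_continuous_map[OF c d] by blast
  obtain g where g: "continuous_on L g" "g ` L \<subseteq> K" "\<And>y w. y \<in> L \<Longrightarrow> y \<in> d w \<longleftrightarrow> g y \<in> c w"
    using cantor_scheme_continuous_map[OF d c] by blast
  have gh: "g (h x) = x" if "x \<in> K" for x
    by (rule cantor_scheme_inverse[OF c d]) (use h g that in auto)
  have hg: "h (g y) = y" if "y \<in> L" for y
    by (rule cantor_scheme_inverse[OF d c]) (use h g that in auto)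
  show ?thesis
  proof (rule homeomorphicI[of h _ _ g])
    show "h ` K = L" using h(2) g(2) hg by (metis image_eqI subsetD subsetI subset_antisym)
    show "g ` L = K" using h(2) g(2) gh by (metis image_eqI subsetD subsetI subset_antisym)
  qed (use h g gh hg in auto)
qed

section \<open>The scheme of the ternary Cantor set\<close>

lemma compact_ternary_stage: "compact (ternary_stage n)"
  by (induction n) (auto intro!: compact_Un compact_continuous_image continuous_intros)

lemma ternary_stage_subset: "ternary_stage n \<subseteq> {0..1}"
  by (induction n) auto

lemma ternary_stage_Suc_subset: "ternary_stage (Suc n) \<subseteq> ternary_stage n"
proof (induction n)
  case (Suc n)
  then show ?case by (subst (1 2) ternary_stage.simps(2)) blast
qed auto

lemma zero_in_ternary_stage: "0 \<in> ternary_stage n"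
proof (induction n)
  case (Suc n)
  then show ?case by (auto intro!: image_eqI[of _ _ 0])
qed auto

lemma compact_ternary_cantor_set: "compact ternary_cantor_set"
  unfolding ternary_cantor_set_def
  by (intro compact_Inter) (auto simp: compact_ternary_stage)

lemma ternary_cantor_set_nonempty: "ternary_cantor_set \<noteq> {}"
  using zero_in_ternary_stage unfolding ternary_cantor_set_def by blast

lemma ternary_cantor_set_subset: "ternary_cantor_set \<subseteq> {0..1}"
  using ternary_stage_subset unfolding ternary_cantor_set_def by blast

definition ternary_branch :: "bool \<Rightarrow> real \<Rightarrow> real" where
  "ternary_branch b x = (if b then 2 / 3 + x / 3 else x / 3)"

text \<open>The side of \<open>1 / 2\<close> on which \<open>x\<close> lies decides, for all stages
  at once, which of the two copies contains it. This is what lets the intersection over the stages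
  pass through the union.\<close>

lemma ternary_cantor_set_branches:
  "ternary_cantor_set = ternary_branch True ` ternary_cantor_set \<union> ternary_branch False ` ternary_cantor_set"
proof (intro equalityI subsetI)
  fix x assume x: "x \<in> ternary_cantor_set"
  have stage: "x \<in> (\<lambda>x. x / 3) ` ternary_stage n \<union> (\<lambda>x. 2 / 3 + x / 3) ` ternary_stage n" for n
    using x unfolding ternary_cantor_set_def ternary_stage.simps(2)[symmetric] by blast
  show "x \<in> ternary_branch True ` ternary_cantor_set \<union> ternary_branch False ` ternary_cantor_set"
  proof (cases "x < 1 / 2")
    case True
    have "3 * x \<in> ternary_stage n" for n
      using stage[of n] True ternary_stage_subset[of n] by force
    then have "ternary_branch False (3 * x) = x" "3 * x \<in> ternary_cantor_set"
      by (auto simp: ternary_branch_def ternary_cantor_set_def)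
    then show ?thesis by (metis UnI2 imageI)
  next
    case False
    have "3 * x - 2 \<in> ternary_stage n" for n
      using stage[of n] False ternary_stage_subset[of n] by force
    then have "ternary_branch True (3 * x - 2) = x" "3 * x - 2 \<in> ternary_cantor_set"
      by (simp_all add: ternary_branch_def ternary_cantor_set_def field_simps)
    then show ?thesis by (metis UnI1 imageI)
  qed
next
  fix x assume "x \<in> ternary_branch True ` ternary_cantor_set \<union> ternary_branch False ` ternary_cantor_set"
  then have "x \<in> ternary_stage (Suc n)" for n
    by (auto simp: ternary_branch_def ternary_cantor_set_def)
  then show "x \<in> ternary_cantor_set"
    using ternary_stage_Suc_subset unfolding ternary_cantor_set_def by blast
qed

lemma ternary_branches_disjoint:
  "ternary_branch True ` ternary_cantor_set \<inter> ternary_branch False ` ternary_cantor_set = {}"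
proof -
  have "ternary_branch True x \<noteq> ternary_branch False y"
    if "x \<in> ternary_cantor_set" "y \<in> ternary_cantor_set" for x y
    using subsetD[OF ternary_cantor_set_subset that(1)] subsetD[OF ternary_cantor_set_subset that(2)]
    by (simp add: ternary_branch_def)
  then show ?thesis by blast
qed

text \<open>The head of the word acts first, that is innermost. Hence the image for
  \<open>b # w\<close> is a part of the image for \<open>w\<close>, as the convention of
  \<open>cantor_scheme\<close> demands.\<close>

primrec ternary_branches :: "bool list \<Rightarrow> real \<Rightarrow> real" where
  "ternary_branches [] = id"
| "ternary_branches (b # w) = ternary_branches w \<circ> ternary_branch b"

lemma ternary_branches_diff: "ternary_branches w x - ternary_branches w y = (x - y) / 3 ^ length w"
proof (induction w arbitrary: x y)
  case (Cons b w)
  have eq: "ternary_branch b x - ternary_branch b y = (x - y) / 3"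
    unfolding ternary_branch_def by (cases b) (simp_all add: diff_divide_distrib)
  have "ternary_branches (b # w) x - ternary_branches (b # w) y = (x - y) / 3 / 3 ^ length w"
    by (simp only: ternary_branches.simps comp_apply Cons.IH eq)
  then show ?case by simp
qed simp

lemma inj_ternary_branches: "inj (ternary_branches w)"
proof (rule injI)
  fix x y assume "ternary_branches w x = ternary_branches w y"
  then show "x = y" using ternary_branches_diff[of w x y] by simp
qed

lemma continuous_on_ternary_branches: "continuous_on S (ternary_branches w)"
proof -
  have "ternary_branches w x = ternary_branches w 0 + x / 3 ^ length w" for x
    using ternary_branches_diff[of w x 0] by simp
  then have "continuous_on S (ternary_branches w) \<longleftrightarrow>
      continuous_on S (\<lambda>x. ternary_branches w 0 + x / 3 ^ length w)"
    by (rule continuous_on_cong[OF refl])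
  then show ?thesis by (auto intro!: continuous_intros)
qed

lemma cantor_scheme_ternary_cantor_set:
  "cantor_scheme ternary_cantor_set (\<lambda>w. ternary_branches w ` ternary_cantor_set)"
  unfolding cantor_scheme_def
proof (intro conjI allI impI)
  fix w
  show "compact (ternary_branches w ` ternary_cantor_set)"
    by (intro compact_continuous_image continuous_on_ternary_branches compact_ternary_cantor_set)
  show "ternary_branches w ` ternary_cantor_set \<noteq> {}"
    using ternary_cantor_set_nonempty by blast
  show "ternary_branches (True # w) ` ternary_cantor_set \<union> ternary_branches (False # w) ` ternary_cantor_set
      = ternary_branches w ` ternary_cantor_set"
    using ternary_cantor_set_branches by (metis image_Un image_comp ternary_branches.simps(2))
  show "ternary_branches (True # w) ` ternary_cantor_set
      \<inter> ternary_branches (False # w) ` ternary_cantor_set = {}"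
    using ternary_branches_disjoint inj_ternary_branches
    by (metis image_Int image_comp image_empty ternary_branches.simps(2))
next
  fix e :: real assume "e > 0"
  then obtain n where n: "(1 / 3) ^ n < e"
    using real_arch_pow_inv[of e "1 / 3"] by auto
  have "dist x y < e" if w: "length w = n" "x \<in> ternary_branches w ` ternary_cantor_set"
    "y \<in> ternary_branches w ` ternary_cantor_set" for w x y
  proof -
    obtain p q where pq: "x = ternary_branches w p" "y = ternary_branches w q" "p \<in> {0..1}" "q \<in> {0..1}"
      using w(2,3) ternary_cantor_set_subset by blast
    have "dist x y = \<bar>p - q\<bar> / 3 ^ n"
      using pq(1,2) w(1) by (simp add: dist_real_def ternary_branches_diff)
    also have "\<dots> \<le> 1 / 3 ^ n"
      using pq(3,4) by (intro divide_right_mono) auto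
    finally show ?thesis using n by (simp add: power_one_over)
  qed
  then show "\<exists>n. \<forall>w x y. length w = n \<longrightarrow> x \<in> ternary_branches w ` ternary_cantor_set \<longrightarrow>
      y \<in> ternary_branches w ` ternary_cantor_set \<longrightarrow> dist x y < e"
    by blast
qed auto

section \<open>Perfect nowhere dense compact sets of reals are Cantor sets\<close>

definition perfect_nowhere_dense :: "real set \<Rightarrow> bool" where
  "perfect_nowhere_dense D \<longleftrightarrow>
     compact D \<and> D \<noteq> {} \<and> interior D = {} \<and> (\<forall>x\<in>D. x islimpt D)"

text \<open>Empty interior provides a point outside \<open>D\<close> in the middle third of its
  convex hull; cutting there leaves two parts of at most two thirds of the length.\<close>

lemma perfect_nowhere_dense_split:
  assumes D: "perfect_nowhere_dense D" and e: "\<And>x y. x \<in> D \<Longrightarrow> y \<in> D \<Longrightarrow> \<bar>x - y\<bar> \<le> e"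
  obtains D0 D1 where "D1 \<union> D0 = D" "D1 \<inter> D0 = {}"
    "perfect_nowhere_dense D0" "\<And>x y. x \<in> D0 \<Longrightarrow> y \<in> D0 \<Longrightarrow> \<bar>x - y\<bar> \<le> 2 / 3 * e"
    "perfect_nowhere_dense D1" "\<And>x y. x \<in> D1 \<Longrightarrow> y \<in> D1 \<Longrightarrow> \<bar>x - y\<bar> \<le> 2 / 3 * e"
proof -
  have compact: "compact D" and ne: "D \<noteq> {}" and int: "interior D = {}"
    and lim: "\<And>x. x \<in> D \<Longrightarrow> x islimpt D"
    using D unfolding perfect_nowhere_dense_def by auto
  obtain u where u: "u \<in> D" "\<And>x. x \<in> D \<Longrightarrow> u \<le> x"
    using compact_attains_inf[OF compact ne] by blast
  obtain v where v: "v \<in> D" "\<And>x. x \<in> D \<Longrightarrow> x \<le> v"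
    using compact_attains_sup[OF compact ne] by blast
  have "u \<noteq> v"
  proof
    assume "u = v"
    then have "D \<subseteq> {u}" using u v by force
    then show False using lim[OF u(1)] by (metis finite.emptyI finite_insert finite_subset islimpt_finite)
  qed
  then have uv: "u < v" using u v by force
  have ve: "2 / 3 * (v - u) \<le> 2 / 3 * e" using e[OF v(1) u(1)] by auto
  define a b where "a = u + (v - u) / 3" and "b = v - (v - u) / 3"
  have ab: "u < a" "a < b" "b < v" using uv by (auto simp: a_def b_def field_simps)
  have "\<not> {a<..<b} \<subseteq> D"
    using ab interior_maximal[of "{a<..<b}" D] int by auto
  then obtain x where x: "a < x" "x < b" "x \<notin> D"
    unfolding subset_iff greaterThanLessThan_iff by blast
  \<comment> \<open>At a missing cut point the closed and the open half-line have the same trace on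
    \<open>D\<close>: the closed one gives compactness, the open one keeps limit points.\<close>
  have perfect: "perfect_nowhere_dense (D \<inter> S)" if "closed S" "open T" "D \<inter> S = D \<inter> T" "D \<inter> S \<noteq> {}" for S T
    unfolding perfect_nowhere_dense_def
  proof (intro conjI ballI)
    show "compact (D \<inter> S)" using compact that(1) by (rule compact_Int_closed)
    show "interior (D \<inter> S) = {}" using int by simp
    fix y assume y: "y \<in> D \<inter> S"
    have "eventually (\<lambda>z. z \<in> T) (at y)"
      using y that by (metis Int_iff eventually_at_topological)
    with y lim show "y islimpt D \<inter> S" by (metis IntD1 islimpt_Int_eventually that(3))
  qed (use that in auto)
  show thesis
  proof (rule that)
    show "(D \<inter> {x..}) \<union> (D \<inter> {..x}) = D" by auto
    show "(D \<inter> {x..}) \<inter> (D \<inter> {..x}) = {}" using x(3) by auto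
    have "D \<inter> {..x} = D \<inter> {..<x}" "u \<in> D \<inter> {..x}"
      using x u(1) ab(1) by (auto simp: order_less_le)
    then show "perfect_nowhere_dense (D \<inter> {..x})"
      by (intro perfect[of _ "{..<x}"]) auto
    have "D \<inter> {x..} = D \<inter> {x<..}" "v \<in> D \<inter> {x..}"
      using x v(1) ab(3) by (auto simp: order_less_le)
    then show "perfect_nowhere_dense (D \<inter> {x..})"
      by (intro perfect[of _ "{x<..}"]) auto
  next
    fix y z assume "y \<in> D \<inter> {..x}" "z \<in> D \<inter> {..x}"
    then have "u \<le> y" "y \<le> x" "u \<le> z" "z \<le> x" using u(2) by auto
    moreover have "x - u \<le> 2 / 3 * (v - u)"
      using x(2) by (simp add: b_def field_simps)
    ultimately show "\<bar>y - z\<bar> \<le> 2 / 3 * e" using ve by linarith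
  next
    fix y z assume "y \<in> D \<inter> {x..}" "z \<in> D \<inter> {x..}"
    then have "x \<le> y" "y \<le> v" "x \<le> z" "z \<le> v" using v(2) by auto
    moreover have "v - x \<le> 2 / 3 * (v - u)"
      using x(1) by (simp add: a_def field_simps)
    ultimately show "\<bar>y - z\<bar> \<le> 2 / 3 * e" using ve by linarith
  qed
qed

lemma perfect_nowhere_dense_cantor_scheme:
  assumes K: "perfect_nowhere_dense K"
  shows "\<exists>c. cantor_scheme K c"
proof -
  have "bounded K"
    using K compact_imp_bounded unfolding perfect_nowhere_dense_def by blast
  then obtain M where M: "\<And>x y. x \<in> K \<Longrightarrow> y \<in> K \<Longrightarrow> \<bar>x - y\<bar> \<le> M"
    unfolding bounded_two_points dist_real_def by blast
  define P where "P n D \<longleftrightarrow> perfect_nowhere_dense D \<and> (\<forall>x\<in>D. \<forall>y\<in>D. \<bar>x - y\<bar> \<le> (2 / 3) ^ n * M)"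
    for n :: nat and D
  \<comment> \<open>The implication stands inside the existential quantifiers so that the choice of
    the two halves becomes a pair of total functions \<open>L\<close> and \<open>R\<close>.\<close>
  have "\<exists>D0 D1. P n D \<longrightarrow> D1 \<union> D0 = D \<and> D1 \<inter> D0 = {} \<and> P (Suc n) D0 \<and> P (Suc n) D1" for n D
  proof (cases "P n D")
    case True
    then have D: "perfect_nowhere_dense D"
      and bound: "\<And>x y. x \<in> D \<Longrightarrow> y \<in> D \<Longrightarrow> \<bar>x - y\<bar> \<le> (2 / 3) ^ n * M"
      by (simp_all add: P_def)
    show ?thesis
    proof (rule perfect_nowhere_dense_split[OF D bound])
      fix D0 D1
      assume "D1 \<union> D0 = D" "D1 \<inter> D0 = {}"
        "perfect_nowhere_dense D0" "\<And>x y. x \<in> D0 \<Longrightarrow> y \<in> D0 \<Longrightarrow> \<bar>x - y\<bar> \<le> 2 / 3 * ((2 / 3) ^ n * M)"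
        "perfect_nowhere_dense D1" "\<And>x y. x \<in> D1 \<Longrightarrow> y \<in> D1 \<Longrightarrow> \<bar>x - y\<bar> \<le> 2 / 3 * ((2 / 3) ^ n * M)"
      then have "D1 \<union> D0 = D \<and> D1 \<inter> D0 = {} \<and> P (Suc n) D0 \<and> P (Suc n) D1"
        by (simp add: P_def mult.assoc)
      then show ?thesis by (intro exI impI)
    qed
  qed blast
  then obtain L R where LR: "\<And>n D. P n D \<Longrightarrow>
      R n D \<union> L n D = D \<and> R n D \<inter> L n D = {} \<and> P (Suc n) (L n D) \<and> P (Suc n) (R n D)"
    by metis
  define c where "c = rec_list K (\<lambda>b w D. if b then R (length w) D else L (length w) D)"
  have c_simps: "c [] = K" "\<And>b w. c (b # w) = (if b then R (length w) (c w) else L (length w) (c w))"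
    unfolding c_def by simp_all
  have P: "P (length w) (c w)" for w
  proof (induction w)
    case Nil
    then show ?case using K M by (simp add: c_simps P_def)
  next
    case (Cons b w)
    then show ?case using LR[OF Cons.IH] by (simp add: c_simps)
  qed
  have "cantor_scheme K c"
    unfolding cantor_scheme_def
  proof (intro conjI allI impI)
    fix w
    show "compact (c w)" "c w \<noteq> {}"
      using P[of w] unfolding P_def perfect_nowhere_dense_def by auto
    show "c (True # w) \<union> c (False # w) = c w" "c (True # w) \<inter> c (False # w) = {}"
      using LR[OF P[of w]] by (simp_all add: c_simps)
  next
    fix e :: real assume e: "e > 0"
    have "(\<lambda>n. (2 / 3) ^ n * M) \<longlonglongrightarrow> 0 * M"
      by (intro tendsto_intros LIMSEQ_power_zero) auto
    then have "eventually (\<lambda>n. (2 / 3) ^ n * M < e) sequentially"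
      using e by (intro order_tendstoD) auto
    then obtain n where n: "(2 / 3) ^ n * M < e"
      by (auto simp: eventually_sequentially)
    have "dist x y < e" if "length w = n" "x \<in> c w" "y \<in> c w" for w x y
      using P[of w] that n unfolding P_def dist_real_def by (meson le_less_trans)
    then show "\<exists>n. \<forall>w x y. length w = n \<longrightarrow> x \<in> c w \<longrightarrow> y \<in> c w \<longrightarrow> dist x y < e"
      by blast
  qed (rule c_simps)
  then show ?thesis by blast
qed

lemma perfect_nowhere_dense_is_cantor_set: "perfect_nowhere_dense K \<Longrightarrow> is_cantor_set K"
  unfolding is_cantor_set_def
  using perfect_nowhere_dense_cantor_scheme cantor_scheme_ternary_cantor_set cantor_schemes_homeomorphic
  by blast

section \<open>Achievement sets of decreasing series\<close>

text \<open>The index set is a parameter so that the same notion covers the whole series, its tails,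
  its initial segments and single blocks.\<close>

definition subsums :: "('i \<Rightarrow> real) \<Rightarrow> 'i set \<Rightarrow> real set" where
  "subsums a N = {x. \<exists>A\<subseteq>N. (a has_sum x) A}"

lemma subsumsI: "A \<subseteq> N \<Longrightarrow> (a has_sum x) A \<Longrightarrow> x \<in> subsums a N"
  unfolding subsums_def by auto

lemma subsumsE:
  assumes "x \<in> subsums a N"
  obtains A where "A \<subseteq> N" "(a has_sum x) A"
  using assms unfolding subsums_def by auto

lemma achievement_set_eq_subsums: "achievement_set a = subsums a {1..}"
  unfolding achievement_set_def subsums_def ..

lemma zero_in_subsums: "0 \<in> subsums a N"
  by (rule subsumsI[of "{}"]) auto

lemma subsums_mono: "M \<subseteq> N \<Longrightarrow> subsums a M \<subseteq> subsums a N"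
  unfolding subsums_def by blast

lemma sum_in_subsums: "finite A \<Longrightarrow> A \<subseteq> N \<Longrightarrow> sum a A \<in> subsums a N"
  by (rule subsumsI[of A]) auto

lemma subsums_add:
  assumes "x \<in> subsums a M" "y \<in> subsums a N" "M \<inter> N = {}" "M \<union> N \<subseteq> L"
  shows "x + y \<in> subsums a L"
proof -
  obtain A where A: "A \<subseteq> M" "(a has_sum x) A" by (rule subsumsE[OF assms(1)])
  obtain B where B: "B \<subseteq> N" "(a has_sum y) B" by (rule subsumsE[OF assms(2)])
  show ?thesis
  proof (rule subsumsI)
    show "(a has_sum (x + y)) (A \<union> B)"
      using A B assms(3) by (intro has_sum_Un_disjoint) auto
    show "A \<union> B \<subseteq> L" using A B assms(4) by auto
  qed
qed

lemma finite_subsums: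
  assumes "finite N"
  shows "finite (subsums a N)"
proof (rule finite_subset)
  show "subsums a N \<subseteq> sum a ` Pow N"
  proof
    fix x assume "x \<in> subsums a N"
    then obtain A where A: "A \<subseteq> N" "(a has_sum x) A" by (rule subsumsE)
    then have "x = sum a A"
      using assms has_sum_finite has_sum_unique by (metis finite_subset)
    with A show "x \<in> sum a ` Pow N" by auto
  qed
qed (use assms in auto)

section \<open>Tails of decreasing positive series and closedness of their sets of subsums\<close>

locale decreasing_series =
  fixes a :: "nat \<Rightarrow> real"
  assumes pos: "\<And>n. 1 \<le> n \<Longrightarrow> 0 < a n"
    and decreasing: "antimono_on {1..} a"
    and summable: "a summable_on {1..}"
begin

lemma decreasingD: "1 \<le> m \<Longrightarrow> m \<le> n \<Longrightarrow> a n \<le> a m"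
  using decreasing by (auto simp: monotone_on_def)

lemma nonneg: "N \<subseteq> {1..} \<Longrightarrow> n \<in> N \<Longrightarrow> 0 \<le> a n"
  using pos[of n] by auto

lemma summable_subset: "N \<subseteq> {1..} \<Longrightarrow> a summable_on N"
  using summable by (rule summable_on_subset)

lemma subsums_nonneg:
  assumes "N \<subseteq> {1..}" "x \<in> subsums a N"
  shows "0 \<le> x"
  using assms(2)
proof (rule subsumsE)
  fix A assume "A \<subseteq> N" "(a has_sum x) A"
  then show ?thesis using nonneg[OF assms(1)] by (intro has_sum_nonneg[of a A x]) auto
qed

lemma subsums_le_infsum:
  assumes "N \<subseteq> {1..}" "x \<in> subsums a N"
  shows "x \<le> infsum a N"
  using assms(2)
proof (rule subsumsE)
  fix A assume "A \<subseteq> N" "(a has_sum x) A"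
  then show ?thesis
    using nonneg[OF assms(1)] has_sum_infsum[OF summable_subset[OF assms(1)]]
    by (intro has_sum_mono2[of a A x N]) auto
qed

lemma subsums_split:
  assumes "M \<union> N \<subseteq> {1..}" "M \<inter> N = {}" "z \<in> subsums a (M \<union> N)"
  obtains x y where "x \<in> subsums a M" "y \<in> subsums a N" "z = x + y"
  using assms(3)
proof (rule subsumsE)
  fix A assume A: "A \<subseteq> M \<union> N" "(a has_sum z) A"
  have "(a has_sum (infsum a (A \<inter> M) + infsum a (A \<inter> N))) ((A \<inter> M) \<union> (A \<inter> N))"
    using assms(1,2) by (intro has_sum_Un_disjoint has_sum_infsum summable_subset) auto
  moreover have "(A \<inter> M) \<union> (A \<inter> N) = A" using A(1) by auto
  ultimately have "z = infsum a (A \<inter> M) + infsum a (A \<inter> N)"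
    using A(2) has_sum_unique by metis
  moreover have "infsum a (A \<inter> M) \<in> subsums a M" "infsum a (A \<inter> N) \<in> subsums a N"
    by (rule subsumsI[OF Int_lower2], rule has_sum_infsum, rule summable_subset, use assms(1) in auto)+
  ultimately show thesis using that by blast
qed

lemma subsums_reflect:
  assumes "N \<subseteq> {1..}" "x \<in> subsums a N"
  shows "infsum a N - x \<in> subsums a N"
  using assms(2)
proof (rule subsumsE)
  fix A assume A: "A \<subseteq> N" "(a has_sum x) A"
  show ?thesis
  proof (rule subsumsI)
    show "(a has_sum (infsum a N - x)) (N - A)"
      using A has_sum_infsum[OF summable_subset[OF assms(1)]] by (intro has_sum_Diff) auto
  qed auto
qed

lemma infsum_mono_subset:
  assumes "M \<subseteq> N" "N \<subseteq> {1..}"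
  shows "infsum a M \<le> infsum a N"
proof (rule subsums_le_infsum[OF assms(2)])
  show "infsum a M \<in> subsums a N"
    using assms by (intro subsumsI[OF assms(1)] has_sum_infsum summable_subset) auto
qed

lemma small_tail:
  assumes "e > 0"
  obtains n where "1 \<le> n" "\<And>m. n \<le> m \<Longrightarrow> infsum a {m..} < e"
proof -
  obtain F where F: "finite F" "F \<subseteq> {1..}" "dist (sum a F) (infsum a {1..}) \<le> e / 2"
    using infsum_finite_approximation[OF summable, of "e / 2"] assms by auto
  \<comment> \<open>Inserting \<open>1\<close> keeps the maximum meaningful when \<open>F\<close> is
    empty.\<close>
  define n where "n = Suc (Max (insert 1 F))"
  have n: "k < n" if "k \<in> F" for k
    using F(1) that by (auto simp: n_def less_Suc_eq_le)
  have "infsum a {m..} < e" if "n \<le> m" for m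
  proof -
    have "{m..} \<subseteq> {1..} - F" using n that by (force simp: n_def)
    then have "infsum a {m..} \<le> infsum a ({1..} - F)"
      by (intro infsum_mono_subset) auto
    also have "\<dots> = infsum a {1..} - sum a F"
      using F(1,2) summable by (subst infsum_Diff) auto
    also have "\<dots> < e" using F(3) assms unfolding dist_real_def by linarith
    finally show ?thesis .
  qed
  then show thesis by (intro that[of n]) (auto simp: n_def)
qed

lemma subsums_atLeast:
  assumes "1 \<le> n"
  shows "subsums a {n..} = subsums a {Suc n..} \<union> (\<lambda>x. a n + x) ` subsums a {Suc n..}"
proof (intro equalityI subsetI)
  fix x assume "x \<in> subsums a {n..}"
  then obtain A where A: "A \<subseteq> {n..}" "(a has_sum x) A" by (rule subsumsE)
  show "x \<in> subsums a {Suc n..} \<union> (\<lambda>x. a n + x) ` subsums a {Suc n..}"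
  proof (cases "n \<in> A")
    case True
    have "(a has_sum (x - a n)) (A - {n})"
      using has_sum_Diff[OF A(2) has_sum_finiteI[of "{n}" "a n" a]] True by auto
    moreover have "A - {n} \<subseteq> {Suc n..}" using A(1) by force
    ultimately have "x - a n \<in> subsums a {Suc n..}" by (intro subsumsI)
    then show ?thesis by (intro UnI2 image_eqI[of _ _ "x - a n"]) auto
  next
    case False
    then have "A \<subseteq> {Suc n..}" using A(1) by (force simp: Suc_le_eq order_less_le)
    with A(2) show ?thesis by (intro UnI1 subsumsI)
  qed
next
  fix x assume x: "x \<in> subsums a {Suc n..} \<union> (\<lambda>x. a n + x) ` subsums a {Suc n..}"
  have "a n + y \<in> subsums a {n..}" if "y \<in> subsums a {Suc n..}" for y
    using sum_in_subsums[of "{n}" "{n}" a] that by (intro subsums_add[of _ _ "{n}" _ "{Suc n..}"]) auto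
  moreover have "subsums a {Suc n..} \<subseteq> subsums a {n..}"
    by (intro subsums_mono) auto
  ultimately show "x \<in> subsums a {n..}" using x by auto
qed

text \<open>
  A point of the closure is expanded greedily: it stays in the closures of the successive tails
  while the terms which have been used are subtracted from it.
\<close>

lemma closed_subsums:
  assumes n: "1 \<le> n"
  shows "closed (subsums a {n..})"
proof -
  have "x \<in> subsums a {n..}" if x: "x \<in> closure (subsums a {n..})" for x
  proof -
    \<comment> \<open>The second clause pins the start of the sequence to \<open>x\<close>, since
      dependent choice alone returns some start satisfying \<open>P 0\<close>.\<close>
    define P where "P k y \<longleftrightarrow> y \<in> closure (subsums a {n + k..}) \<and> (k = 0 \<longrightarrow> y = x)" for k y
    have "\<exists>y'. P (Suc k) y' \<and> (y' = y \<or> y' = y - a (n + k))" if "P k y" for k y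
    proof -
      have "y \<in> closure (subsums a {Suc (n + k)..}) \<union> (\<lambda>x. a (n + k) + x) ` closure (subsums a {Suc (n + k)..})"
        using that subsums_atLeast[of "n + k"] n
        by (simp add: P_def closure_translation)
      then show ?thesis by (auto simp: P_def)
    qed
    moreover have "\<exists>y. P 0 y" using x by (simp add: P_def)
    ultimately obtain f where f: "\<And>k. P k (f k)" "\<And>k. f (Suc k) = f k \<or> f (Suc k) = f k - a (n + k)"
      using dependent_nat_choice[of P "\<lambda>k y y'. y' = y \<or> y' = y - a (n + k)"] by blast
    \<comment> \<open>These are the indices whose terms were subtracted; \<open>f k\<close> is what
      remains of \<open>x\<close> after \<open>k\<close> decisions.\<close>
    define A where "A = {n + k |k. f (Suc k) \<noteq> f k}"
    have mem: "n + k \<in> A \<longleftrightarrow> f (Suc k) \<noteq> f k" for k by (auto simp: A_def)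
    have partial: "sum a (A \<inter> {n..<n + k}) = x - f k" for k
    proof (induction k)
      case 0
      then show ?case using f(1)[of 0] by (simp add: P_def)
    next
      case (Suc k)
      have "{n..<n + Suc k} = insert (n + k) {n..<n + k}" by auto
      then have "A \<inter> {n..<n + Suc k} =
          (if n + k \<in> A then insert (n + k) (A \<inter> {n..<n + k}) else A \<inter> {n..<n + k})" by auto
      then show ?case using Suc.IH f(2)[of k] mem[of k] by auto
    qed
    have f_bounds: "f k \<in> {0..infsum a {n + k..}}" for k
    proof -
      have "subsums a {n + k..} \<subseteq> {0..infsum a {n + k..}}"
        using n subsums_nonneg[of "{n + k..}"] subsums_le_infsum[of "{n + k..}"] by fastforce
      then have "closure (subsums a {n + k..}) \<subseteq> {0..infsum a {n + k..}}"
        by (rule closure_minimal) simp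
      then show ?thesis using f(1)[of k] by (auto simp: P_def)
    qed
    have An: "A \<subseteq> {n..}" by (auto simp: A_def)
    \<comment> \<open>The difference equals the part of \<open>A\<close> beyond \<open>n + m\<close>
      minus the remainder \<open>f m\<close>, and both lie between 0 and a tail smaller than
      \<open>e\<close>.\<close>
    have "\<bar>infsum a A - x\<bar> \<le> e" if "e > 0" for e
    proof -
      obtain m where m: "\<And>k. m \<le> k \<Longrightarrow> infsum a {k..} < e"
        using small_tail[OF \<open>e > 0\<close>] by blast
      have "infsum a ((A \<inter> {n..<n + m}) \<union> (A \<inter> {n + m..})) =
          infsum a (A \<inter> {n..<n + m}) + infsum a (A \<inter> {n + m..})"
        using n by (intro infsum_Un_disjoint summable_subset) auto
      moreover have "(A \<inter> {n..<n + m}) \<union> (A \<inter> {n + m..}) = A" using An by auto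
      ultimately have "infsum a A = x - f m + infsum a (A \<inter> {n + m..})"
        using partial[of m] by simp
      moreover have "0 \<le> infsum a (A \<inter> {n + m..})"
        using n by (intro infsum_nonneg nonneg[of "{n + m..}"]) auto
      moreover have "infsum a (A \<inter> {n + m..}) \<le> infsum a {n + m..}"
        using n by (intro infsum_mono_subset) auto
      ultimately show ?thesis using f_bounds[of m] m[of "n + m"] by auto
    qed
    then have "infsum a A = x"
      using field_le_epsilon[of "\<bar>infsum a A - x\<bar>" 0] by auto
    moreover have "(a has_sum infsum a A) A"
      using An n by (intro has_sum_infsum summable_subset) auto
    ultimately show ?thesis using An by (auto intro: subsumsI)
  qed
  then show ?thesis using closure_subset_eq by blast
qed

lemma compact_achievement_set: "compact (achievement_set a)"
proof -
  have "achievement_set a \<subseteq> {0..infsum a {1..}}"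
    using subsums_nonneg[of "{1..}"] subsums_le_infsum[of "{1..}"]
    unfolding achievement_set_eq_subsums by fastforce
  then have "bounded (achievement_set a)" using bounded_closed_interval bounded_subset by blast
  then show ?thesis
    using closed_subsums[of 1] by (simp add: compact_eq_bounded_closed achievement_set_eq_subsums)
qed

section \<open>Local structure of the achievement set\<close>

lemma achievement_set_split:
  assumes "1 \<le> n" "x \<in> achievement_set a"
  obtains s t where "s \<in> subsums a {1..<n}" "t \<in> subsums a {n..}" "x = s + t"
    "s \<in> achievement_set a" "0 \<le> t" "t \<le> infsum a {n..}"
proof -
  have eq: "{1..<n} \<union> {n..} = {1..}" using assms(1) by auto
  obtain s t where st: "s \<in> subsums a {1..<n}" "t \<in> subsums a {n..}" "x = s + t"
  proof (rule subsums_split[of "{1..<n}" "{n..}" x])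
    show "x \<in> subsums a ({1..<n} \<union> {n..})"
      using assms(2) unfolding eq achievement_set_eq_subsums .
  qed (use assms(1) in auto)
  show thesis
  proof (rule that[OF st])
    have "subsums a {1..<n} \<subseteq> subsums a {1..}" by (rule subsums_mono) auto
    then show "s \<in> achievement_set a" using st(1) unfolding achievement_set_eq_subsums by blast
    show "0 \<le> t" "t \<le> infsum a {n..}"
      using st(2) assms(1) subsums_nonneg[of "{n..}" t] subsums_le_infsum[of "{n..}" t] by auto
  qed
qed

lemma achievement_set_add:
  assumes "1 \<le> n" "s \<in> subsums a {1..<n}" "t \<in> subsums a {n..}"
  shows "s + t \<in> achievement_set a"
  unfolding achievement_set_eq_subsums
  using assms(2,3) by (rule subsums_add) (use assms(1) in auto)

text \<open>If some index up to \<open>k\<close> is used, its term alone is at least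
  \<open>a k\<close> by monotonicity; otherwise the whole sum is bounded by the tail after
  \<open>k\<close>.\<close>

lemma subsums_gap:
  assumes n: "1 \<le> n" "n \<le> k" and t: "t \<in> subsums a {n..}"
  shows "t \<le> infsum a {Suc k..} \<or> a k \<le> t"
  using t
proof (rule subsumsE)
  fix A assume A: "A \<subseteq> {n..}" "(a has_sum t) A"
  show ?thesis
  proof (cases "A \<subseteq> {Suc k..}")
    case True
    then have "t \<in> subsums a {Suc k..}" using A(2) by (rule subsumsI)
    then show ?thesis using subsums_le_infsum[of "{Suc k..}" t] by auto
  next
    case False
    then obtain i where i: "i \<in> A" "i \<le> k" by force
    have "sum a {i} \<le> t"
      using A(2) by (rule finite_sum_le_has_sum) (use i A(1) n nonneg[of "{n..}"] in auto)
    then show ?thesis using decreasingD[of i k] i A(1) n by auto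
  qed
qed

text \<open>
  The finitely many sums of leading terms are isolated from each other, so to the right of a right
  end of a gap the achievement set looks like a tail near \<open>0\<close>, which has arbitrarily small gaps.
\<close>

lemma achievement_set_not_right_interval:
  assumes gaps: "\<exists>\<^sub>\<infinity>k. infsum a {Suc k..} < a k"
    and x: "x \<in> achievement_set a" and e: "e > 0"
    and left: "{x - e<..<x} \<inter> achievement_set a = {}"
    and right: "{x<..<x + e} \<subseteq> achievement_set a"
  shows False
proof -
  obtain n where n: "1 \<le> n" "\<And>m. n \<le> m \<Longrightarrow> infsum a {m..} < e"
    using small_tail[OF e] by blast
  have start: "x \<le> s" if "s \<in> achievement_set a" "x - e < s" for s
    using left that by force
  have "finite (subsums a {1..<n})" by (rule finite_subsums) simp
  then obtain d where d: "d > 0" "\<And>s. s \<in> subsums a {1..<n} \<Longrightarrow> s \<noteq> x \<Longrightarrow> d \<le> dist x s"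
    using finite_set_avoid by meson
  obtain m where m: "1 \<le> m" "\<And>k. m \<le> k \<Longrightarrow> infsum a {k..} < min d e"
    using small_tail[of "min d e"] d(1) e by auto
  obtain k where k: "max m n \<le> k" "infsum a {Suc k..} < a k"
    using gaps unfolding INFM_nat_le by blast
  \<comment> \<open>The midpoint of a gap of the tail. As \<open>c < e\<close>, the point
    \<open>x + c\<close> lies in the assumed interval, and \<open>c < d\<close> will force its
    leading sum to be \<open>x\<close> itself.\<close>
  define c where "c = (infsum a {Suc k..} + a k) / 2"
  have c: "infsum a {Suc k..} < c" "c < a k" using k(2) by (auto simp: c_def)
  have "0 \<le> infsum a {Suc k..}" by (intro infsum_nonneg nonneg[of "{Suc k..}"]) auto
  moreover have "a k \<le> infsum a {k..}"
    using subsums_le_infsum[of "{k..}" "a k"] sum_in_subsums[of "{k}" "{k..}" a] k(1) n(1) by auto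
  ultimately have c_bounds: "0 < c" "c < d" "c < e" using c m(2)[of k] k(1) by auto
  have "x + c \<in> achievement_set a"
    using right c_bounds by auto
  then obtain s t where st: "s \<in> subsums a {1..<n}" "t \<in> subsums a {n..}" "x + c = s + t"
      "s \<in> achievement_set a" "0 \<le> t" "t \<le> infsum a {n..}"
    using achievement_set_split[OF n(1)] by metis
  \<comment> \<open>From \<open>t < e\<close> and \<open>c > 0\<close> follows
    \<open>s > x - e\<close>, and the gap to the left of \<open>x\<close> excludes values below
    \<open>x\<close>. Then \<open>x \<le> s \<le> x + c < x + d\<close> leaves only
    \<open>s = x\<close>, which puts \<open>c\<close> among the subsums of the tail.\<close>
  have "x \<le> s" using start[OF st(4)] st(3,6) n(2)[of n] c_bounds(1) by auto
  then have "s = x" using d(2)[OF st(1)] st(3,5) c_bounds(2) by (auto simp: dist_real_def)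
  then have "t = c" using st(3) by simp
  then show False using subsums_gap[OF n(1) _ st(2), of k] k(1) c by auto
qed

lemma achievement_set_reflect:
  "infsum a {1..} - x \<in> achievement_set a \<longleftrightarrow> x \<in> achievement_set a"
  using subsums_reflect[of "{1..}" x] subsums_reflect[of "{1..}" "infsum a {1..} - x"]
  unfolding achievement_set_eq_subsums by auto

text \<open>Passing to complementary index sets reflects the achievement set onto itself and
  exchanges left and right, which reduces this to the mirrored case.\<close>

lemma achievement_set_not_left_interval:
  assumes gaps: "\<exists>\<^sub>\<infinity>k. infsum a {Suc k..} < a k"
    and x: "x \<in> achievement_set a" and e: "e > 0"
    and left: "{x - e<..<x} \<subseteq> achievement_set a"
    and right: "{x<..<x + e} \<inter> achievement_set a = {}"
  shows False
proof (rule achievement_set_not_right_interval[OF gaps _ e])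
  let ?S = "infsum a {1..}"
  show "?S - x \<in> achievement_set a" using x achievement_set_reflect by blast
  show "{?S - x - e<..<?S - x} \<inter> achievement_set a = {}"
  proof -
    have "y \<notin> achievement_set a" if "y \<in> {?S - x - e<..<?S - x}" for y
    proof -
      have "?S - y \<in> {x<..<x + e}" using that by auto
      then show ?thesis using right achievement_set_reflect[of y] by blast
    qed
    then show ?thesis by blast
  qed
  show "{?S - x<..<?S - x + e} \<subseteq> achievement_set a"
  proof
    fix y assume "y \<in> {?S - x<..<?S - x + e}"
    then have "?S - y \<in> {x - e<..<x}" by auto
    then show "y \<in> achievement_set a" using left achievement_set_reflect[of y] by blast
  qed
qed

text \<open>Write \<open>x\<close> as a leading sum plus a tail part. Replacing the tail part by an
  interior point of the tail's subsums gives an interior point of the achievement set and moves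
  \<open>x\<close> by less than the total of that tail.\<close>

lemma achievement_set_regular_closed:
  assumes tails: "\<And>n. 1 \<le> n \<Longrightarrow> interior (subsums a {n..}) \<noteq> {}"
  shows "achievement_set a = closure (interior (achievement_set a))"
proof (rule equalityI)
  show "closure (interior (achievement_set a)) \<subseteq> achievement_set a"
    by (intro closure_minimal interior_subset compact_imp_closed compact_achievement_set)
  show "achievement_set a \<subseteq> closure (interior (achievement_set a))"
  proof
    fix x assume x: "x \<in> achievement_set a"
    show "x \<in> closure (interior (achievement_set a))"
      unfolding closure_approachable
    proof (intro allI impI)
      fix e :: real assume "e > 0"
      then obtain n where n: "1 \<le> n" "\<And>m. n \<le> m \<Longrightarrow> infsum a {m..} < e"
        using small_tail by blast
      obtain s t where st: "s \<in> subsums a {1..<n}" "t \<in> subsums a {n..}" "x = s + t"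
        "s \<in> achievement_set a" "0 \<le> t" "t \<le> infsum a {n..}"
        by (rule achievement_set_split[OF n(1) x])
      obtain g where g: "g \<in> interior (subsums a {n..})" using tails[OF n(1)] by blast
      have "(\<lambda>y. s + y) ` interior (subsums a {n..}) \<subseteq> interior (achievement_set a)"
      proof (rule interior_maximal)
        show "(\<lambda>y. s + y) ` interior (subsums a {n..}) \<subseteq> achievement_set a"
          using achievement_set_add[OF n(1) st(1)] interior_subset by blast
      qed (simp add: open_translation)
      then have "s + g \<in> interior (achievement_set a)" using g by blast
      moreover have "0 \<le> g" "g \<le> infsum a {n..}"
        using g interior_subset[of "subsums a {n..}"] n(1)
          subsums_nonneg[of "{n..}" g] subsums_le_infsum[of "{n..}" g] by auto
      then have "dist (s + g) x < e"
        using st(3,5,6) n(2)[of n] by (simp add: dist_real_def)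
      ultimately show "\<exists>y\<in>interior (achievement_set a). dist y x < e" by blast
    qed
  qed
qed

text \<open>Near an isolated frontier point each side lies entirely inside or entirely outside the
  set. Inside on both sides makes the point interior, outside on both sides contradicts regular
  closedness, and the mixed cases are the two excluded above.\<close>

lemma frontier_achievement_set_perfect:
  assumes gaps: "\<exists>\<^sub>\<infinity>k. infsum a {Suc k..} < a k"
    and tails: "\<And>n. 1 \<le> n \<Longrightarrow> interior (subsums a {n..}) \<noteq> {}"
    and x: "x \<in> frontier (achievement_set a)"
  shows "x islimpt frontier (achievement_set a)"
proof (rule ccontr)
  let ?E = "achievement_set a"
  assume "\<not> x islimpt frontier ?E"
  then obtain e where e: "e > 0" "\<And>y. y \<in> frontier ?E \<Longrightarrow> y \<noteq> x \<Longrightarrow> \<not> dist y x < e"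
    unfolding islimpt_approachable by blast
  have closed: "closed ?E" by (intro compact_imp_closed compact_achievement_set)
  have xE: "x \<in> ?E" using x frontier_subset_closed[OF closed] by blast
  \<comment> \<open>A connected set meeting both \<open>?E\<close> and its complement meets the
    frontier.\<close>
  have dichotomy: "I \<subseteq> ?E \<or> I \<inter> ?E = {}" if I: "connected I" "I \<subseteq> ball x e - {x}" for I
  proof (rule ccontr)
    assume "\<not> ?thesis"
    then have "I \<inter> frontier ?E \<noteq> {}" by (intro connected_Int_frontier I(1)) auto
    then obtain y where "y \<in> I" "y \<in> frontier ?E" by blast
    then show False using e(2)[of y] subsetD[OF I(2), of y] by (auto simp: dist_commute)
  qed
  have left: "{x - e<..<x} \<subseteq> ?E \<or> {x - e<..<x} \<inter> ?E = {}"
    by (rule dichotomy) (auto simp: dist_real_def)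
  have right: "{x<..<x + e} \<subseteq> ?E \<or> {x<..<x + e} \<inter> ?E = {}"
    by (rule dichotomy) (auto simp: dist_real_def)
  have split: "ball x e = {x - e<..<x} \<union> {x} \<union> {x<..<x + e}"
    using e(1) by (auto simp: ball_eq_greaterThanLessThan)
  have "\<not> ({x - e<..<x} \<subseteq> ?E \<and> {x<..<x + e} \<subseteq> ?E)"
  proof
    assume "{x - e<..<x} \<subseteq> ?E \<and> {x<..<x + e} \<subseteq> ?E"
    then have "ball x e \<subseteq> ?E" using xE unfolding split by auto
    then have "x \<in> interior ?E" using e(1) mem_interior by blast
    then show False using x by (simp add: frontier_def)
  qed
  moreover have "\<not> ({x - e<..<x} \<inter> ?E = {} \<and> {x<..<x + e} \<inter> ?E = {})"
  proof
    assume "{x - e<..<x} \<inter> ?E = {} \<and> {x<..<x + e} \<inter> ?E = {}"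
    then have "ball x e \<inter> ?E \<subseteq> {x}" unfolding split by auto
    then have "ball x e \<inter> interior ?E \<subseteq> {x}" using interior_subset[of ?E] by auto
    moreover have "open (ball x e \<inter> interior ?E)" by auto
    moreover have "ball x e \<inter> interior ?E \<noteq> {}"
    proof -
      have "x \<in> closure (interior ?E)"
        using achievement_set_regular_closed[OF tails] xE by simp
      then obtain y where "y \<in> interior ?E" "dist y x < e"
        using e(1) unfolding closure_approachable by blast
      then show ?thesis by (auto simp: dist_commute)
    qed
    ultimately have "open {x}" by (metis subset_singletonD)
    then show False by (simp add: not_open_singleton)
  qed
  ultimately show False
    using left right achievement_set_not_left_interval[OF gaps xE e(1)]
      achievement_set_not_right_interval[OF gaps xE e(1)] by blast
qed

lemma is_cantorval_achievement_set:
  assumes gaps: "\<exists>\<^sub>\<infinity>k. infsum a {Suc k..} < a k"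
    and tails: "\<And>n. 1 \<le> n \<Longrightarrow> interior (subsums a {n..}) \<noteq> {}"
  shows "is_cantorval (achievement_set a)"
proof -
  let ?E = "achievement_set a"
  have compact: "compact ?E" by (rule compact_achievement_set)
  have "interior (frontier ?E) \<subseteq> interior ?E"
    by (intro interior_mono frontier_subset_closed compact_imp_closed compact)
  moreover have "interior (frontier ?E) \<inter> interior ?E = {}"
    using interior_subset[of "frontier ?E"] by (auto simp: frontier_def)
  ultimately have "interior (frontier ?E) = {}" by blast
  moreover have "frontier ?E \<noteq> {}"
  proof -
    have "0 \<in> ?E" by (simp only: achievement_set_eq_subsums zero_in_subsums)
    moreover have "?E \<noteq> UNIV" using compact compact_imp_bounded not_bounded_UNIV by metis
    ultimately show ?thesis by (auto simp: frontier_eq_empty)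
  qed
  moreover have "\<forall>x\<in>frontier ?E. x islimpt frontier ?E"
    using frontier_achievement_set_perfect[OF gaps tails] by blast
  ultimately have "perfect_nowhere_dense (frontier ?E)"
    using compact_frontier[OF compact] by (simp add: perfect_nowhere_dense_def)
  then show ?thesis
    unfolding is_cantorval_def
    using perfect_nowhere_dense_is_cantor_set compact_imp_bounded[OF compact]
      achievement_set_regular_closed[OF tails] by simp
qed

end

section \<open>A sequence of blocks\<close>

text \<open>The shift by one makes the blocks, counted from 0, start at index 1 and leave no
  positive index out.\<close>

definition block_start :: "nat \<Rightarrow> nat" where
  "block_start k = (Suc k)\<^sup>2"

lemma block_start_Suc: "block_start k + 3 \<le> block_start (Suc k)"
  by (simp add: block_start_def power2_eq_square)

lemma strict_mono_start: "strict_mono block_start"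
  unfolding strict_mono_Suc_iff
proof
  show "block_start k < block_start (Suc k)" for k using block_start_Suc[of k] by linarith
qed

lemma le_start: "Suc k \<le> block_start k"
  by (simp add: block_start_def power2_eq_square)

lemma between_starts: "block_start k < n \<Longrightarrow> n < block_start (Suc k) \<Longrightarrow> n \<notin> range block_start"
  using strict_mono_start by (auto simp: strict_mono_less less_Suc_eq_le)

text \<open>Here \<open>inv block_start n\<close> is the number of the block that starts at
  \<open>n\<close>. The extra summand at a start is one unit \<open>2 / 2 ^ s\<close>, with
  \<open>s\<close> the start of the next block; it turns the first term into the odd multiple
  \<open>2^m + 1\<close> of that unit.\<close>

definition block_seq :: "nat \<Rightarrow> real" where
  "block_seq n = (if n \<in> range block_start then 1 / 2 ^ n + 2 / 2 ^ block_start (Suc (inv block_start n)) else 2 / 2 ^ n)"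

lemma block_seq_start: "block_seq (block_start k) = 1 / 2 ^ block_start k + 2 / 2 ^ block_start (Suc k)"
  using strict_mono_imp_inj_on[OF strict_mono_start] by (simp add: block_seq_def)

lemma block_seq_start_less: "block_seq (block_start k) < 2 / 2 ^ block_start k"
proof -
  have "(2::real) ^ (block_start k + 3) \<le> 2 ^ block_start (Suc k)"
    by (rule power_increasing[OF block_start_Suc]) simp
  then have "2 / 2 ^ block_start (Suc k) \<le> 2 / (2::real) ^ (block_start k + 3)"
    by (intro divide_left_mono) auto
  also have "\<dots> < 1 / 2 ^ block_start k" by (simp add: power_add field_simps)
  finally show ?thesis by (simp add: block_seq_start field_simps)
qed

lemma block_seq_le: "block_seq n \<le> 2 / 2 ^ n"
proof (cases "n \<in> range block_start")
  case True
  then obtain k where "n = block_start k" by blast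
  then show ?thesis using block_seq_start_less[of k] by simp
qed (simp add: block_seq_def)

lemma block_seq_greater: "1 / 2 ^ n < block_seq n"
  by (simp add: block_seq_def divide_simps)

lemma block_seq_pos: "0 < block_seq n"
  by (rule less_trans[OF _ block_seq_greater]) simp

text \<open>The bounds on neighbouring terms meet: \<open>2 / 2 ^ Suc n\<close> is
  \<open>1 / 2 ^ n\<close>.\<close>

lemma antimono_block_seq: "antimono block_seq"
proof -
  have "block_seq (Suc n) \<le> block_seq n" for n
    using block_seq_le[of "Suc n"] block_seq_greater[of n] by simp
  then show ?thesis by (simp add: antimono_iff_le_Suc)
qed

section \<open>Comparison with the geometric series\<close>

text \<open>In the dominating series every term equals the sum of all later ones, so any strict loss
  in the tail makes a term exceed it.\<close>

lemma has_sum_halves: "((\<lambda>i. 2 / 2 ^ i :: real) has_sum (2 / 2 ^ k)) {Suc k..}"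
proof -
  have "((\<lambda>i. 2 / 2 ^ k * (1 / 2) ^ i) has_sum (2 / 2 ^ k * ((1 / 2) / (1 - 1 / 2 :: real)))) {1..}"
    by (intro has_sum_cmult_right has_sum_geometric_from_1) simp
  also have "?this \<longleftrightarrow> ((\<lambda>i. 2 / 2 ^ i) has_sum (2 / 2 ^ k * ((1 / 2) / (1 - 1 / 2 :: real)))) {Suc k..}"
    by (rule has_sum_reindex_bij_witness[of _ "\<lambda>i. i - k" "\<lambda>i. i + k"]) (auto simp: power_add field_simps)
  finally show ?thesis by simp
qed

lemma summable_on_halves: "(\<lambda>i. 2 / 2 ^ i :: real) summable_on {1..}"
  using has_sum_halves[of 0] unfolding summable_on_def One_nat_def by blast

lemma summable_block_seq: "block_seq summable_on {1..}"
  by (rule summable_on_comparison_test[OF summable_on_halves])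
    (use block_seq_le block_seq_pos less_imp_le in auto)

interpretation block_seq: decreasing_series block_seq
  using block_seq_pos antimono_block_seq summable_block_seq
  by unfold_locales (auto intro: monotone_on_subset)

text \<open>Strictness comes from a later block start, here \<open>block_start n\<close>, where the
  term is strictly below the geometric one.\<close>

lemma tail_block_seq_less: "infsum block_seq {Suc n..} < 2 / 2 ^ n"
proof (rule has_sum_strict_mono)
  show "(block_seq has_sum infsum block_seq {Suc n..}) {Suc n..}"
    by (intro has_sum_infsum block_seq.summable_subset) auto
  show "((\<lambda>i. 2 / 2 ^ i :: real) has_sum 2 / 2 ^ n) {Suc n..}" by (rule has_sum_halves)
  show "block_start n \<in> {Suc n..}" using le_start by simp
qed (rule block_seq_le block_seq_start_less)+

section \<open>Intervals of subsums in every tail\<close>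

text \<open>Binary expansion of \<open>s\<close> in units of the smallest term; the induction splits
  off the last digit \<open>s mod 2\<close>.\<close>

lemma binary_subsums:
  assumes "\<And>n. t < n \<Longrightarrow> n \<le> t + m \<Longrightarrow> a n = 2 / 2 ^ n" "s < 2 ^ m"
  shows "2 * real s / 2 ^ (t + m) \<in> subsums a {t<..t + m}"
  using assms
proof (induction m arbitrary: s)
  case 0
  then show ?case by (simp add: zero_in_subsums)
next
  case (Suc m)
  have split: "{t<..t + Suc m} = {t<..t + m} \<union> {t + Suc m}" by auto
  have "2 * real (s div 2) / 2 ^ (t + m) \<in> subsums a {t<..t + m}"
    using Suc.prems by (intro Suc.IH) auto
  moreover have "real (s mod 2) * (2 / 2 ^ (t + Suc m)) \<in> subsums a {t + Suc m}"
    using sum_in_subsums[of "{t + Suc m}" "{t + Suc m}" a] zero_in_subsums[of a "{t + Suc m}"] Suc.prems(1)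
    by (cases "even s") (auto simp: odd_iff_mod_2_eq_one)
  ultimately have "2 * real (s div 2) / 2 ^ (t + m) + real (s mod 2) * (2 / 2 ^ (t + Suc m))
      \<in> subsums a {t<..t + Suc m}"
    by (rule subsums_add) auto
  moreover have "real s = 2 * real (s div 2) + real (s mod 2)"
    by (metis mult_div_mod_eq of_nat_add of_nat_mult of_nat_numeral)
  then have "2 * real (s div 2) / 2 ^ (t + m) + real (s mod 2) * (2 / 2 ^ (t + Suc m)) = 2 * real s / 2 ^ (t + Suc m)"
    by (simp add: add_divide_distrib)
  ultimately show ?case by simp
qed

text \<open>The width of a grid: all terms of the blocks before block \<open>k\<close> are integer
  multiples of it.\<close>

definition block_unit :: "nat \<Rightarrow> real" where
  "block_unit k = 2 / 2 ^ block_start k"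

lemma block_unit_pos: "0 < block_unit k"
  by (simp add: block_unit_def)

lemma block_unit_eq:
  assumes "j \<le> k"
  shows "block_unit j = 2 ^ (block_start k - block_start j) * block_unit k"
proof -
  have "block_start j \<le> block_start k" using assms strict_mono_start by (simp add: strict_mono_less_eq)
  then show ?thesis by (simp add: block_unit_def power_diff)
qed

text \<open>
  In multiples of \<open>block_unit (Suc k)\<close>, the first term of block \<open>k\<close> is odd and greater by one than the sum of the
  other ones, which are consecutive powers of \<open>2\<close>. So both the even and the odd multiples
  reached by a block continue those reached by the previous blocks without holes.
\<close>

lemma consecutive_block_sums:
  assumes "j \<le> k"
  shows "\<exists>u. real u * block_unit k \<le> 2 / 3 * (block_unit j - block_unit k) \<and>
    (\<forall>z. u \<le> z \<longrightarrow> z < 2 ^ (block_start k - block_start j) \<longrightarrow>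
      real z * block_unit k \<in> subsums block_seq {block_start j..<block_start k})"
  using assms
proof (induction k rule: dec_induct)
  case base
  then show ?case by (intro exI[of _ 0]) (auto simp: zero_in_subsums)
next
  case (step k)
  \<comment> \<open>The number of powers of 2 that follow the first term of block
    \<open>k\<close>.\<close>
  define m where "m = block_start (Suc k) - block_start k - 1"
  have m: "block_start (Suc k) = block_start k + m + 1" "1 \<le> m" using block_start_Suc[of k] by (auto simp: m_def)
  have jk: "block_start j \<le> block_start k" using step.hyps strict_mono_start by (simp add: strict_mono_less_eq)
  have block_unit: "block_unit k = 2 * 2 ^ m * block_unit (Suc k)"
    using block_unit_eq[of k "Suc k"] m(1) by simp
  have block_start_term: "block_seq (block_start k) = (2 ^ m + 1) * block_unit (Suc k)"
    by (simp add: block_seq_start block_unit_def m(1) power_add field_simps)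
  have width: "block_start (Suc k) - block_start j = block_start k - block_start j + m + 1" using m(1) jk by simp
  obtain u where u: "real u * block_unit k \<le> 2 / 3 * (block_unit j - block_unit k)"
    "\<And>z. u \<le> z \<Longrightarrow> z < 2 ^ (block_start k - block_start j) \<Longrightarrow> real z * block_unit k \<in> subsums block_seq {block_start j..<block_start k}"
    using step.IH by blast
  \<comment> \<open>Even multiples arise without the odd first term: earlier blocks supply
    \<open>q div 2 ^ m\<close> coarse units, each worth \<open>2 * 2 ^ m\<close> fine ones, and the
    powers of 2 in the block supply the rest \<open>q mod 2 ^ m\<close>.\<close>
  have even: "2 * real q * block_unit (Suc k) \<in> subsums block_seq ({block_start j..<block_start k} \<union> {block_start k<..block_start k + m})"
    if q: "2 ^ m * u \<le> q" "q < 2 ^ (block_start k - block_start j) * 2 ^ m" for q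
  proof -
    have "u \<le> q div 2 ^ m" using q(1) by (simp add: less_eq_div_iff_mult_less_eq mult.commute)
    moreover have "q div 2 ^ m < 2 ^ (block_start k - block_start j)" using q(2) by (rule less_mult_imp_div_less)
    ultimately have "real (q div 2 ^ m) * block_unit k \<in> subsums block_seq {block_start j..<block_start k}" by (rule u(2))
    moreover have "2 * real (q mod 2 ^ m) / 2 ^ (block_start k + m) \<in> subsums block_seq {block_start k<..block_start k + m}"
    proof (rule binary_subsums)
      fix n assume "block_start k < n" "n \<le> block_start k + m"
      then show "block_seq n = 2 / 2 ^ n"
        using between_starts[of k n] m(1) by (simp add: block_seq_def)
    qed simp
    ultimately have "real (q div 2 ^ m) * block_unit k + 2 * real (q mod 2 ^ m) / 2 ^ (block_start k + m)
        \<in> subsums block_seq ({block_start j..<block_start k} \<union> {block_start k<..block_start k + m})"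
      by (rule subsums_add) auto
    moreover have "real (q div 2 ^ m) * block_unit k + 2 * real (q mod 2 ^ m) / 2 ^ (block_start k + m) = 2 * real q * block_unit (Suc k)"
    proof -
      have "real q = real (2 ^ m * (q div 2 ^ m) + q mod 2 ^ m)" by simp
      also have "\<dots> = 2 ^ m * real (q div 2 ^ m) + real (q mod 2 ^ m)" by (simp only: of_nat_add of_nat_mult of_nat_power of_nat_numeral)
      finally have q_eq: "real q = 2 ^ m * real (q div 2 ^ m) + real (q mod 2 ^ m)" .
      have "1 / 2 ^ (block_start k + m) = block_unit (Suc k)" by (simp add: block_unit_def m(1))
      then have "2 * real (q mod 2 ^ m) / 2 ^ (block_start k + m) = 2 * real (q mod 2 ^ m) * block_unit (Suc k)"
        by (metis times_divide_eq_right mult.right_neutral)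
      then show ?thesis unfolding block_unit by (subst q_eq) (simp add: algebra_simps)
    qed
    ultimately show ?thesis by simp
  qed
  show ?case
  \<comment> \<open>Even multiples are available from \<open>2 * 2 ^ m * u\<close> on, odd ones only
    after adding the first term \<open>2 ^ m + 1\<close>; hence the shift by
    \<open>2 ^ m\<close>.\<close>
  proof (intro exI[of _ "2 * 2 ^ m * u + 2 ^ m"] conjI allI impI)
    have eq: "real (2 * 2 ^ m * u + 2 ^ m) * block_unit (Suc k) = real u * block_unit k + block_unit k / 2"
      unfolding block_unit by (simp add: algebra_simps)
    \<comment> \<open>The lower end moves by \<open>block_unit k / 2\<close> in this step. Since the
      unit shrinks at least fourfold, this is at most
      \<open>2 / 3 * (block_unit k - block_unit (Suc k))\<close>, and these bounds
      telescope.\<close>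
    have "4 * block_unit (Suc k) \<le> block_unit k"
    proof -
      have "(2::real) ^ 1 \<le> 2 ^ m" using m(2) by (intro power_increasing) auto
      then show ?thesis unfolding block_unit using block_unit_pos[of "Suc k"] by (intro mult_right_mono) auto
    qed
    then show "real (2 * 2 ^ m * u + 2 ^ m) * block_unit (Suc k) \<le> 2 / 3 * (block_unit j - block_unit (Suc k))"
      unfolding eq using u(1) by (simp add: field_simps)
  next
    fix z assume z: "2 * 2 ^ m * u + 2 ^ m \<le> z" "z < 2 ^ (block_start (Suc k) - block_start j)"
    have z_less: "z < 2 * (2 ^ (block_start k - block_start j) * 2 ^ m)" using z(2) by (simp add: width power_add)
    show "real z * block_unit (Suc k) \<in> subsums block_seq {block_start j..<block_start (Suc k)}"
    proof (cases "even z")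
      case True
      then obtain q where q: "z = 2 * q" by (rule evenE)
      have "2 * real q * block_unit (Suc k) \<in> subsums block_seq ({block_start j..<block_start k} \<union> {block_start k<..block_start k + m})"
        using z(1) z_less q by (intro even) auto
      moreover have "subsums block_seq ({block_start j..<block_start k} \<union> {block_start k<..block_start k + m})
          \<subseteq> subsums block_seq {block_start j..<block_start (Suc k)}"
        using m(1) jk by (intro subsums_mono) auto
      ultimately show ?thesis using q by auto
    next
      case False
      then obtain r where r: "z = 2 * r + 1" by (rule oddE)
      \<comment> \<open>As \<open>2 ^ m\<close> is even, subtracting the odd first term from
        \<open>z\<close> leaves an even multiple \<open>2 * p\<close>, and the lower bound on
        \<open>z\<close> becomes \<open>2 ^ m * u \<le> p\<close>.\<close>
      have "even ((2::nat) ^ m)" using m(2) by simp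
      then obtain h :: nat where h: "2 ^ m = 2 * h" by (rule evenE)
      define X where "X = 2 ^ m * u"
      have "2 * X + 2 * h \<le> 2 * r + 1" using z(1) unfolding r X_def h by simp
      then have "X + h \<le> r" by linarith
      then obtain q where "r = X + h + q" using le_iff_add by blast
      then have q: "z = 2 * (X + q) + 2 ^ m + 1" by (simp add: r h)
      define p where "p = X + q"
      have "2 * real p * block_unit (Suc k) \<in> subsums block_seq ({block_start j..<block_start k} \<union> {block_start k<..block_start k + m})"
        using z_less q by (intro even) (auto simp: X_def p_def)
      moreover have "sum block_seq {block_start k} \<in> subsums block_seq {block_start k}"
        by (rule sum_in_subsums) auto
      ultimately have "2 * real p * block_unit (Suc k) + sum block_seq {block_start k} \<in> subsums block_seq {block_start j..<block_start (Suc k)}"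
        by (rule subsums_add) (use m(1) jk in auto)
      moreover have "2 * real p * block_unit (Suc k) + sum block_seq {block_start k} = real z * block_unit (Suc k)"
        by (simp add: q p_def block_start_term algebra_simps)
      ultimately show ?thesis by simp
    qed
  qed
qed

lemma block_unit_arbitrarily_small:
  assumes "e > 0"
  obtains k where "j \<le> k" "block_unit k < e"
proof -
  obtain i where i: "(1 / 2) ^ i < e / 2"
    using real_arch_pow_inv[of "e / 2" "1 / 2"] assms by auto
  have "block_unit (max i j) = 2 * (1 / 2) ^ block_start (max i j)" by (simp add: block_unit_def power_one_over)
  also have "\<dots> \<le> 2 * (1 / 2) ^ i"
    using le_start[of "max i j"] by (intro mult_left_mono power_decreasing) auto
  also have "\<dots> < e" using i by simp
  finally show thesis by (intro that[of "max i j"]) auto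
qed

text \<open>All grid points of width \<open>block_unit k\<close> in this interval are subsums, and
  the grids become arbitrarily fine; closedness of the set of subsums does the rest.\<close>

lemma interval_subset_tail:
  "{2 / 3 * block_unit j<..<block_unit j} \<subseteq> subsums block_seq {block_start j..}"
proof
  fix y assume y: "y \<in> {2 / 3 * block_unit j<..<block_unit j}"
  have "y \<in> closure (subsums block_seq {block_start j..})"
    unfolding closure_approachable
  proof (intro allI impI)
    fix e :: real assume "e > 0"
    \<comment> \<open>The second bound leaves room to round \<open>y\<close> up to the grid without
      reaching \<open>block_unit j\<close>.\<close>
    then obtain k where k: "j \<le> k" "block_unit k < min e (block_unit j - y)"
      using block_unit_arbitrarily_small[of "min e (block_unit j - y)" j] y by auto
    obtain u where u: "real u * block_unit k \<le> 2 / 3 * (block_unit j - block_unit k)"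
      "\<And>z. u \<le> z \<Longrightarrow> z < 2 ^ (block_start k - block_start j) \<Longrightarrow> real z * block_unit k \<in> subsums block_seq {block_start j..<block_start k}"
      using consecutive_block_sums[OF k(1)] by blast
    define z where "z = nat \<lceil>y / block_unit k\<rceil>"
    have "0 < y" using y block_unit_pos[of j] by auto
    then have "real z = of_int \<lceil>y / block_unit k\<rceil>" using block_unit_pos[of k] by (simp add: z_def ceiling_mono)
    then have "y / block_unit k \<le> real z" "real z < y / block_unit k + 1" by linarith+
    then have z: "y \<le> real z * block_unit k" "real z * block_unit k < y + block_unit k"
      using block_unit_pos[of k] by (simp_all add: field_simps)
    have "real u * block_unit k \<le> y" using u(1) y block_unit_pos[of k] by auto
    then have "real u * block_unit k \<le> real z * block_unit k" using z(1) by (rule order_trans)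
    then have "u \<le> z" using block_unit_pos[of k] by (simp only: mult_le_cancel_right_pos of_nat_le_iff)
    moreover have "real z * block_unit k < real (2 ^ (block_start k - block_start j)) * block_unit k"
      using z(2) k(2) block_unit_eq[OF k(1)] by simp
    then have "z < 2 ^ (block_start k - block_start j)"
      using block_unit_pos[of k] by (simp only: mult_less_cancel_right_pos of_nat_less_iff)
    ultimately have "real z * block_unit k \<in> subsums block_seq {block_start j..<block_start k}" by (rule u(2))
    moreover have "subsums block_seq {block_start j..<block_start k} \<subseteq> subsums block_seq {block_start j..}"
      by (rule subsums_mono) auto
    moreover have "dist (real z * block_unit k) y < e" using z k(2) by (simp add: dist_real_def)
    ultimately show "\<exists>x\<in>subsums block_seq {block_start j..}. dist x y < e" by blast
  qed
  moreover have "closed (subsums block_seq {block_start j..})"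
    using le_start[of j] by (intro block_seq.closed_subsums) auto
  ultimately show "y \<in> subsums block_seq {block_start j..}" by simp
qed

lemma interior_tail_block_seq: "interior (subsums block_seq {n..}) \<noteq> {}"
proof -
  have "subsums block_seq {block_start n..} \<subseteq> subsums block_seq {n..}"
    using le_start[of n] by (intro subsums_mono) auto
  then have "{2 / 3 * block_unit n<..<block_unit n} \<subseteq> interior (subsums block_seq {n..})"
    using interval_subset_tail[of n] by (intro interior_maximal) auto
  moreover have "5 / 6 * block_unit n \<in> {2 / 3 * block_unit n<..<block_unit n}" using block_unit_pos[of n] by simp
  ultimately show ?thesis by blast
qed

section \<open>Gaps, density and the final example\<close>

lemma tail_block_seq_less_term:
  assumes "n \<notin> range block_start"
  shows "infsum block_seq {Suc n..} < block_seq n"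
  using tail_block_seq_less[of n] assms by (simp add: block_seq_def)

lemma block_seq_gaps: "\<exists>\<^sub>\<infinity>n. infsum block_seq {Suc n..} < block_seq n"
  unfolding INFM_nat_le
proof
  fix m
  have "block_start m + 1 \<notin> range block_start" using block_start_Suc[of m] by (intro between_starts[of m]) auto
  moreover have "m \<le> block_start m + 1" using le_start[of m] by simp
  ultimately show "\<exists>n\<ge>m. infsum block_seq {Suc n..} < block_seq n" using tail_block_seq_less_term by blast
qed

text \<open>There are at most \<open>sqrt n\<close> positive squares up to \<open>n\<close>, and
  \<open>sqrt n / n\<close> tends to 0.\<close>

lemma density_zero_if_subset_squares:
  assumes "A \<subseteq> range block_start"
  shows "has_asymptotic_density A 0"
proof -
  have card: "real (card {k \<in> A. 1 \<le> k \<and> k \<le> n}) \<le> sqrt (real n)" for n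
  proof -
    have "{k \<in> A. 1 \<le> k \<and> k \<le> n} \<subseteq> block_start ` {..<nat \<lfloor>sqrt (real n)\<rfloor>}"
    proof
      fix x assume "x \<in> {k \<in> A. 1 \<le> k \<and> k \<le> n}"
      then obtain k where k: "x = block_start k" "block_start k \<le> n" using assms by auto
      then have "(real (Suc k))\<^sup>2 \<le> real n" unfolding block_start_def by (metis of_nat_le_iff of_nat_power)
      then have "real (Suc k) \<le> sqrt (real n)" by (rule real_le_rsqrt)
      then have "k < nat \<lfloor>sqrt (real n)\<rfloor>" by linarith
      then show "x \<in> block_start ` {..<nat \<lfloor>sqrt (real n)\<rfloor>}" using k(1) by blast
    qed
    then have "card {k \<in> A. 1 \<le> k \<and> k \<le> n} \<le> card {..<nat \<lfloor>sqrt (real n)\<rfloor>}"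
      by (rule surj_card_le[OF finite_lessThan])
    moreover have "real (nat \<lfloor>sqrt (real n)\<rfloor>) \<le> sqrt (real n)" by simp
    ultimately show ?thesis unfolding card_lessThan by linarith
  qed
  have lim: "(\<lambda>n. 1 / sqrt (real n)) \<longlonglongrightarrow> 0"
    by (intro tendsto_divide_0[OF tendsto_const] filterlim_at_top_imp_at_infinity
        filterlim_compose[OF sqrt_at_top filterlim_real_sequentially])
  \<comment> \<open>At \<open>n = 0\<close> both quotients are 0 by the convention for division by
    zero, so the estimate holds for every \<open>n\<close>.\<close>
  have le: "real (card {k \<in> A. 1 \<le> k \<and> k \<le> n}) / real n \<le> 1 / sqrt (real n)" for n
    using divide_right_mono[OF card[of n], of "real n"] by (simp add: sqrt_divide_self_eq inverse_eq_divide)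
  show ?thesis
    unfolding has_asymptotic_density_def
    by (rule real_tendsto_sandwich[OF always_eventually always_eventually tendsto_const lim]) (use le in simp_all)
qed

theorem corollary8:
  shows "\<exists>a :: nat \<Rightarrow> real.
    (\<forall>n\<ge>1. 0 < a n) \<and>
    antimono_on {1..} a \<and>
    a summable_on {1..} \<and>
    is_cantorval (achievement_set a) \<and>
    has_asymptotic_density {n. 1 \<le> n \<and> a n \<le> tail_sum a n} 0"
proof (intro exI conjI allI impI)
  show "0 < block_seq n" for n by (rule block_seq_pos)
  show "antimono_on {1..} block_seq" by (rule block_seq.decreasing)
  show "block_seq summable_on {1..}" by (rule summable_block_seq)
  show "is_cantorval (achievement_set block_seq)"
    using block_seq_gaps interior_tail_block_seq by (rule block_seq.is_cantorval_achievement_set)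
  \<comment> \<open>By contraposition: off the block starts every term exceeds its tail, with
    \<open>{n<..}\<close> rewritten as \<open>{Suc n..}\<close>.\<close>
  have "n \<in> range block_start" if "block_seq n \<le> tail_sum block_seq n" for n
    using that tail_block_seq_less_term[of n] by (auto simp: tail_sum_def simp flip: atLeast_Suc_greaterThan)
  then show "has_asymptotic_density {n. 1 \<le> n \<and> block_seq n \<le> tail_sum block_seq n} 0"
    by (intro density_zero_if_subset_squares) blast
qed

end
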